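(* (Subject reduction.) Let $J_1 = \Gamma \vdash_S t_1:A_1$ and $J_2 = \Delta \vdash_{S'} t_2:A_2$ be two typing judgements of the dagger lambda calculus such that $J_1$ reduces to $J_2$, $J_1 \longrightarrow J_2$, by use of a soup reduction rule (bifunctoriality, trace, cancellation or consumption) taking the soup $S$ to $S'$. Then the reduction does not alter type assignments: the list of types of the terms in $\Gamma$ equals the list of types of the terms in $\Delta$, and $A_1 \equiv A_2$.
   Context: The dagger lambda calculus. Types are generated from atomic types by $A^*$ and $A\otimes B$, with $(A^* )^*\equiv A$ and $(A\otimes B)^* := B^*\otimes A^*$; one atomic type $I$, with $I\equiv I^*$, acts as tensor unit. Terms are generated from typed variables and typed constants by $t_*$ and $t\otimes u$; if $t:A$ and $u:B$ then $t_*:A^*$ and $t\otimes u:A\otimes B$; $(t_* )_*\equiv t$ and $(t\otimes u)_* := u_*\otimes t_*$. For each type $A$ there is a constant $D_A:I$, with $D_I=1$ and $1=1_*$. A soup connection $t:u$ (also $t:_A u$) is an ordered pair of terms of the same type $A$, with the identification $t:u\equiv u_*:t_*$ and negation $(t:u)_* := t_*:u_*\equiv u:t$. A soup is a set of connections $\{v_1:v_2,\dots,v_{m-1}:v_m\}$; $S_*$ negates each connection. A typing judgement (sequent) has the form $t_1:A_1,\dots,t_n:A_n\vdash_S t:B$ with $S$ a soup ($\vdash$ means empty soup). A variable is bound if it occurs twice in the judgement (anywhere, including the soup); a term is bound (captured) if it contains no constants and all its variables are bound. $\alpha$-renaming replaces all occurrences of a bound variable by a constant-free term of the same type made of variables not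 occurring in the judgement, or replaces both occurrences of a bound term occurring twice by a fresh variable of the same type; $\alpha$-equivalence is its reflexive symmetric transitive closure. For $\Delta=t_1:T_1,\dots,t_n:T_n$, $\bigotimes\Delta$ is $((t_1\otimes t_2)\otimes\dots)\otimes t_n:((T_1\otimes T_2)\otimes\dots)\otimes T_n$. Judgements are derived by the following rules. Id: $x:A\vdash x:A$. Negation: from $a:A\vdash_S b:B$ infer $a_*:A^*\vdash_{S_*}b_*:B^*$. Cut: from $\Gamma\vdash_{S_1}a:A$ and $a':A,\Delta\vdash_{S_2}b:B$ infer $\Gamma,\Delta\vdash_{S_1\cup S_2\cup\{a:a'\}}b:B$. $\otimes R$: from $\Gamma\vdash_{S_1}a:A$ and $\Delta\vdash_{S_2}b:B$ infer $\Gamma,\bigotimes\Delta\vdash_{S_1\cup S_2}a\otimes b:A\otimes B$. Curry (both directions): $a:A,\Gamma\vdash_S b:B$ iff $\Gamma\vdash_S a_*\otimes b:A^*\otimes B$. $\otimes L$ (both directions): $\Gamma,a:A,b:B\vdash_S c:C$ iff $\Gamma,a\otimes b:A\otimes B\vdash_S c:C$. Exchange: adjacent left-hand terms may be swapped. Unit rules (both directions): $\Gamma\vdash_{S\cup\{i_*:1\}}b:B$ iff $i:I,\Gamma\vdash_S b:B$; and $\Gamma\vdash_{S\cup\{i_*:1\}}b:B$ iff $\Gamma,i:I\vdash_S b:B$. The premises of Cut and $\otimes R$ must share no variables ($\alpha$-rename first if needed), so every variable in a derivable judgement occurs exactly twice (linearity). Constants are introduced by $\vdash 1:I$ and, for a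 constant $f:A^*\otimes B$, by $a:A\vdash_{\{f:a_*\otimes b\}}b:B$. Soup reduction extends $\alpha$-equivalence by four rules. Bifunctoriality: $S\cup\{a\otimes b:c\otimes d\}\to S\cup\{a:c,b:d\}$. Trace: $S\cup\{x:_A x\}\to S\cup\{D_A:1\}$ ($x$ a variable). Cancellation: $S\cup\{1:1\}\to S$. Consumption: $\Gamma\vdash_{S\cup\{t:u\}}b:B\to(\Gamma\vdash_S b:B)[t/u]$ if $u$ contains no constants, or $\to(\Gamma\vdash_S b:B)[u/t]$ if $t$ contains no constants; here $[t/u]$ substitutes $t$ for $u$ throughout the whole judgement (including the soup), and the term substituted for must be one that was captured in the judgement. *)

theory Defs
  imports Main
begin

text \<open>
  Types and terms are represented by their negation normal forms with respect to the
  identifications (A*)* = A, (A \<otimes> B)* = B* \<otimes> A*, I* = I and, for terms, (t_*)_* = t,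
  (t \<otimes> u)_* = u_* \<otimes> t_*, 1_* = 1: star is applied to atoms only, and the identifications
  become equalities.
\<close>

datatype 'a ty =
    Atom 'a
  | AtomStar 'a
  | Unit
  | TTensor "'a ty" "'a ty" (infixr "\<otimes>\<^sub>T" 70)

primrec tstar :: "'a ty \<Rightarrow> 'a ty" where
  "tstar (Atom a) = AtomStar a"
| "tstar (AtomStar a) = Atom a"
| "tstar Unit = Unit"
| "tstar (A \<otimes>\<^sub>T B) = tstar B \<otimes>\<^sub>T tstar A"

lemma tstar_tstar [simp]: "tstar (tstar A) = A"
  by (induction A) simp_all

text \<open>Variables carry their type, so that every type has infinitely many variables.\<close>

type_synonym 'a var = "nat \<times> 'a ty"

datatype ('a, 'c) const =
    Sym 'c "'a ty"
  | Dim "'a ty"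

datatype ('a, 'c) trm =
    Var "'a var"
  | VarStar "'a var"
  | Const "('a, 'c) const"
  | ConstStar "('a, 'c) const"
  | One
  | Tensor "('a, 'c) trm" "('a, 'c) trm" (infixr "\<otimes>" 70)

text \<open>
  The constant D_A.  Since D_I is the constant 1, the symbol \<^term>\<open>Dim Unit\<close> is not
  used for D_I; it is merely one more constant of type I.
\<close>

definition dim :: "'a ty \<Rightarrow> ('a, 'c) trm" where
  "dim A = (if A = Unit then One else Const (Dim A))"

primrec star :: "('a, 'c) trm \<Rightarrow> ('a, 'c) trm" where
  "star (Var x) = VarStar x"
| "star (VarStar x) = Var x"
| "star (Const k) = ConstStar k"
| "star (ConstStar k) = Const k"
| "star One = One"
| "star (t \<otimes> u) = star u \<otimes> star t"

lemma star_star [simp]: "star (star t) = t"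
  by (induction t) simp_all

lemma star_eq_iff: "star t = u \<longleftrightarrow> t = star u"
  by auto

primrec const_type :: "('a, 'c) const \<Rightarrow> 'a ty" where
  "const_type (Sym c A) = A"
| "const_type (Dim A) = Unit"

primrec type_of :: "('a, 'c) trm \<Rightarrow> 'a ty" where
  "type_of (Var x) = snd x"
| "type_of (VarStar x) = tstar (snd x)"
| "type_of (Const k) = const_type k"
| "type_of (ConstStar k) = tstar (const_type k)"
| "type_of One = Unit"
| "type_of (t \<otimes> u) = type_of t \<otimes>\<^sub>T type_of u"

lemma type_of_star [simp]: "type_of (star t) = tstar (type_of t)"
  by (induction t) simp_all

primrec const_free :: "('a, 'c) trm \<Rightarrow> bool" where
  "const_free (Var x) \<longleftrightarrow> True"
| "const_free (VarStar x) \<longleftrightarrow> True"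
| "const_free (Const k) \<longleftrightarrow> False"
| "const_free (ConstStar k) \<longleftrightarrow> False"
| "const_free One \<longleftrightarrow> False"
| "const_free (t \<otimes> u) \<longleftrightarrow> const_free t \<and> const_free u"

primrec vars :: "('a, 'c) trm \<Rightarrow> 'a var set" where
  "vars (Var x) = {x}"
| "vars (VarStar x) = {x}"
| "vars (Const k) = {}"
| "vars (ConstStar k) = {}"
| "vars One = {}"
| "vars (t \<otimes> u) = vars t \<union> vars u"

text \<open>
  \<open>occ u s\<close> counts the occurrences of \<open>u\<close> in \<open>s\<close>, and \<open>subst t u s\<close> is s[t/u]: \<open>t\<close>
  replaces \<open>u\<close> in \<open>s\<close>.  An occurrence of u_* is an occurrence of \<open>u\<close> and is replaced by t_*.
\<close>

fun occ :: "('a, 'c) trm \<Rightarrow> ('a, 'c) trm \<Rightarrow> nat" where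
  "occ u (a \<otimes> b) = (if a \<otimes> b = u \<or> a \<otimes> b = star u then 1 else occ u a + occ u b)"
| "occ u s = (if s = u \<or> s = star u then 1 else 0)"

lemma occ_star [simp]: "occ u (star s) = occ u s"
proof (induction s)
  case (Tensor a b)
  have "star (a \<otimes> b) = u \<longleftrightarrow> a \<otimes> b = star u" "star (a \<otimes> b) = star u \<longleftrightarrow> a \<otimes> b = u"
    by (simp_all only: star_eq_iff star_star)
  with Tensor show ?case by (auto simp del: star_star)
qed (auto simp: star_eq_iff eq_commute [of _ "star u"] split: if_splits)

fun subst :: "('a, 'c) trm \<Rightarrow> ('a, 'c) trm \<Rightarrow> ('a, 'c) trm \<Rightarrow> ('a, 'c) trm" where
  "subst t u (a \<otimes> b) =
    (if a \<otimes> b = u then t else if a \<otimes> b = star u then star t else subst t u a \<otimes> subst t u b)"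
| "subst t u s = (if s = u then t else if s = star u then star t else s)"

text \<open>Connections are ordered pairs of terms up to the identification of t:u with u_*:t_*.\<close>

definition conn_eq :: "('a, 'c) trm \<times> ('a, 'c) trm \<Rightarrow> ('a, 'c) trm \<times> ('a, 'c) trm \<Rightarrow> bool" where
  "conn_eq p q \<longleftrightarrow> q = p \<or> q = (star (snd p), star (fst p))"

quotient_type ('a, 'c) connection = "('a, 'c) trm \<times> ('a, 'c) trm" / conn_eq
  by (auto intro!: equivpI reflpI sympI transpI simp: conn_eq_def)

lift_definition Conn :: "('a, 'c) trm \<Rightarrow> ('a, 'c) trm \<Rightarrow> ('a, 'c) connection" is Pair .

lift_definition conn_typed :: "('a, 'c) connection \<Rightarrow> bool" is
  "\<lambda>(t, u). type_of t = type_of u"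
  by (auto simp: conn_eq_def dest: arg_cong [of _ _ tstar])

lift_definition conn_occ :: "('a, 'c) trm \<Rightarrow> ('a, 'c) connection \<Rightarrow> nat" is
  "\<lambda>u (a, b). occ u a + occ u b"
  by (auto simp: conn_eq_def)

lemma Conn_star: "Conn (star u) (star t) = Conn t u"
  by transfer (auto simp: conn_eq_def)

lemma Conn_eq_iff: "Conn t u = Conn t' u' \<longleftrightarrow> t' = t \<and> u' = u \<or> t' = star u \<and> u' = star t"
  by transfer (auto simp: conn_eq_def)

lemma conn_typed_Conn [simp]: "conn_typed (Conn t u) \<longleftrightarrow> type_of t = type_of u"
  by transfer simp

lemma conn_occ_Conn [simp]: "conn_occ s (Conn t u) = occ s t + occ s u"
  by transfer simp

type_synonym ('a, 'c) soup = "('a, 'c) connection set"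

text \<open>
  Both representatives t:u and u_*:t_* of a connection are substituted into.  They yield the same
  connection unless the term substituted for is its own negation.
\<close>

definition soup_subst :: "('a, 'c) trm \<Rightarrow> ('a, 'c) trm \<Rightarrow> ('a, 'c) soup \<Rightarrow> ('a, 'c) soup" where
  "soup_subst t u S = {Conn (subst t u a) (subst t u b) | a b. Conn a b \<in> S}"

text \<open>
  As terms determine their types, the annotations in t_1:A_1, ..., t_n:A_n \<turnstile>_S t:B
  are given by \<^const>\<open>type_of\<close>.  A typing judgement is a sequent with a finite soup of
  well-typed connections; it need not be derivable, as soup reduction can leave the derivable
  sequents (the trace rule introduces D_A:1).
\<close>

datatype ('a, 'c) sequent =
  Sequent "('a, 'c) trm list" "('a, 'c) soup" "('a, 'c) trm" ("(_ \<turnstile>\<^bsub>_\<^esub> _)" [51, 0, 51] 50)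

primrec typing_judgement :: "('a, 'c) sequent \<Rightarrow> bool" where
  "typing_judgement (\<Gamma> \<turnstile>\<^bsub>S\<^esub> t) \<longleftrightarrow> finite S \<and> (\<forall>c\<in>S. conn_typed c)"

primrec seq_occ :: "('a, 'c) trm \<Rightarrow> ('a, 'c) sequent \<Rightarrow> nat" where
  "seq_occ u (\<Gamma> \<turnstile>\<^bsub>S\<^esub> t) = (\<Sum>s\<leftarrow>\<Gamma>. occ u s) + (\<Sum>c\<in>S. conn_occ u c) + occ u t"

primrec seq_subst :: "('a, 'c) trm \<Rightarrow> ('a, 'c) trm \<Rightarrow> ('a, 'c) sequent \<Rightarrow> ('a, 'c) sequent" where
  "seq_subst t u (\<Gamma> \<turnstile>\<^bsub>S\<^esub> s) = (map (subst t u) \<Gamma> \<turnstile>\<^bsub>soup_subst t u S\<^esub> subst t u s)"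

definition bound :: "'a var \<Rightarrow> ('a, 'c) sequent \<Rightarrow> bool" where
  "bound x J \<longleftrightarrow> seq_occ (Var x) J = 2"

definition captured :: "('a, 'c) trm \<Rightarrow> ('a, 'c) sequent \<Rightarrow> bool" where
  "captured t J \<longleftrightarrow> const_free t \<and> (\<forall>x\<in>vars t. bound x J)"

definition fresh :: "'a var \<Rightarrow> ('a, 'c) sequent \<Rightarrow> bool" where
  "fresh x J \<longleftrightarrow> seq_occ (Var x) J = 0"

inductive alpha_step :: "('a, 'c) sequent \<Rightarrow> ('a, 'c) sequent \<Rightarrow> bool" where
  variable: "typing_judgement J \<Longrightarrow> bound x J \<Longrightarrow> const_free t \<Longrightarrow> type_of t = snd x \<Longrightarrow>
    (\<forall>y\<in>vars t. fresh y J) \<Longrightarrow> alpha_step J (seq_subst t (Var x) J)"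
| bound_term: "typing_judgement J \<Longrightarrow> captured u J \<Longrightarrow> seq_occ u J = 2 \<Longrightarrow> fresh x J \<Longrightarrow>
    snd x = type_of u \<Longrightarrow> alpha_step J (seq_subst (Var x) u J)"

definition alpha_equiv :: "('a, 'c) sequent \<Rightarrow> ('a, 'c) sequent \<Rightarrow> bool" where
  "alpha_equiv = equivclp alpha_step"

inductive soup_red :: "('a, 'c) sequent \<Rightarrow> ('a, 'c) sequent \<Rightarrow> bool" (infix "\<longrightarrow>\<^sub>s" 45) where
  alpha: "alpha_equiv J J' \<Longrightarrow> J \<longrightarrow>\<^sub>s J'"
| bifunctoriality:
    "(\<Gamma> \<turnstile>\<^bsub>S \<union> {Conn (a \<otimes> b) (c \<otimes> d)}\<^esub> t) \<longrightarrow>\<^sub>s (\<Gamma> \<turnstile>\<^bsub>S \<union> {Conn a c, Conn b d}\<^esub> t)"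
| trace:
    "(\<Gamma> \<turnstile>\<^bsub>S \<union> {Conn (Var x) (Var x)}\<^esub> t) \<longrightarrow>\<^sub>s (\<Gamma> \<turnstile>\<^bsub>S \<union> {Conn (dim (snd x)) One}\<^esub> t)"
| cancellation:
    "(\<Gamma> \<turnstile>\<^bsub>S \<union> {Conn One One}\<^esub> t) \<longrightarrow>\<^sub>s (\<Gamma> \<turnstile>\<^bsub>S\<^esub> t)"
| consumption_right:
    "const_free u \<Longrightarrow> captured u (\<Gamma> \<turnstile>\<^bsub>S \<union> {Conn t u}\<^esub> b) \<Longrightarrow>
     (\<Gamma> \<turnstile>\<^bsub>S \<union> {Conn t u}\<^esub> b) \<longrightarrow>\<^sub>s seq_subst t u (\<Gamma> \<turnstile>\<^bsub>S\<^esub> b)"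
| consumption_left:
    "const_free t \<Longrightarrow> captured t (\<Gamma> \<turnstile>\<^bsub>S \<union> {Conn t u}\<^esub> b) \<Longrightarrow>
     (\<Gamma> \<turnstile>\<^bsub>S \<union> {Conn t u}\<^esub> b) \<longrightarrow>\<^sub>s seq_subst u t (\<Gamma> \<turnstile>\<^bsub>S\<^esub> b)"

end

theory Submission
  imports Defs
begin

text \<open>Types are read off the left-hand terms and the conclusion, so a rule that rewrites only
  the soup cannot alter them. The other rules substitute one term for another throughout, and a
  substitution between terms of equal type preserves every type (\<open>type_of_subst\<close>). In
  consumption the two types agree because the consumed connection is well typed.\<close>

text \<open>An occurrence of \<open>star u\<close> becomes \<open>star t\<close>; these also have
  equal types, since \<open>star\<close> acts on types as \<open>tstar\<close>.\<close>

lemma type_of_subst: "type_of t = type_of u \<Longrightarrow> type_of (subst t u s) = type_of s"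
  by (induction t u s rule: subst.induct) (auto dest: arg_cong [of _ _ type_of])

primrec seq_types :: "('a, 'c) sequent \<Rightarrow> 'a ty list \<times> 'a ty" where
  "seq_types (\<Gamma> \<turnstile>\<^bsub>S\<^esub> t) = (map type_of \<Gamma>, type_of t)"

lemma seq_types_seq_subst:
  "type_of t = type_of u \<Longrightarrow> seq_types (seq_subst t u J) = seq_types J"
  by (cases J) (simp add: type_of_subst)

text \<open>The side conditions of both renaming rules force the exchanged terms to have the same
  type.\<close>

lemma seq_types_alpha_step: "alpha_step J J' \<Longrightarrow> seq_types J' = seq_types J"
  by (induction rule: alpha_step.induct) (simp_all add: seq_types_seq_subst)

lemma seq_types_alpha_equiv:
  assumes "alpha_equiv J J'"
  shows "seq_types J' = seq_types J"
  using assms unfolding alpha_equiv_def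
  by (induction rule: equivclp_induct) (auto dest: seq_types_alpha_step)

lemma seq_types_soup_red:
  assumes "J \<longrightarrow>\<^sub>s J'" and "typing_judgement J"
  shows "seq_types J' = seq_types J"
  using assms
proof cases
  case alpha
  then show ?thesis by (rule seq_types_alpha_equiv)
next
  case (consumption_right u \<Gamma> S t b)
  \<comment> \<open>\<open>Conn t u\<close> lies in the soup of the typing judgement
    \<open>J\<close>.\<close>
  with assms(2) have "type_of t = type_of u" by simp
  then show ?thesis
    unfolding consumption_right(2) by (subst seq_types_seq_subst) (simp_all add: consumption_right(1))
next
  case (consumption_left t \<Gamma> S u b)
  with assms(2) have "type_of u = type_of t" by simp
  then show ?thesis
    unfolding consumption_left(2) by (subst seq_types_seq_subst) (simp_all add: consumption_left(1))
\<comment> \<open>Bifunctoriality, trace and cancellation leave everything outside the soup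
  fixed.\<close>
qed simp_all

theorem theorem2p3:
  fixes \<Gamma> \<Delta> :: "('a, 'c) trm list" and S S' :: "('a, 'c) soup"
    and t\<^sub>1 t\<^sub>2 :: "('a, 'c) trm" and A\<^sub>1 A\<^sub>2 :: "'a ty"
  assumes "typing_judgement (\<Gamma> \<turnstile>\<^bsub>S\<^esub> t\<^sub>1)" and "type_of t\<^sub>1 = A\<^sub>1"
    and "typing_judgement (\<Delta> \<turnstile>\<^bsub>S'\<^esub> t\<^sub>2)" and "type_of t\<^sub>2 = A\<^sub>2"
    and "(\<Gamma> \<turnstile>\<^bsub>S\<^esub> t\<^sub>1) \<longrightarrow>\<^sub>s (\<Delta> \<turnstile>\<^bsub>S'\<^esub> t\<^sub>2)"
  shows "map type_of \<Gamma> = map type_of \<Delta> \<and> A\<^sub>1 = A\<^sub>2"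
  using seq_types_soup_red [OF assms(5,1)] assms(2,4) by simp

end
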